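(* Let $\eta,\varepsilon:F\dashv U:\mathcal{B}\to\mathcal{A}$ be an adjunction between categories (so $F:\mathcal{A}\to\mathcal{B}$), let $b_0$ be an object of $\mathcal{B}$, and let $\mathbf{G}=(FU,\varepsilon,F\eta U)$ be the comonad on $\mathcal{B}$ generated by the adjunction. If $F$ is comonadic, then the map $$\Psi_{F,b_0}:\mathbf{Sub}_{\mathcal{A},F}(U(b_0))\to\mathbf{G}\text{-coalg}(b_0),\qquad [(a,i_a)]\mapsto FU(\xi_{i_a})\cdot F(\eta_a)\cdot\xi_{i_a}^{-1}$$ is bijective.
   Context: A subobject of an object $x$ is an equivalence class $[(a,i_a)]$ of monomorphisms $i_a:a\to x$, where $i_a\sim i_{a'}$ iff there is an isomorphism $k:a\to a'$ with $i_a=i_{a'}k$. $\mathbf{Sub}_{\mathcal{A},F}(U(b_0))$ is the class of subobjects $[(a,i_a:a\to U(b_0))]$ of $U(b_0)$ in $\mathcal{A}$ for which the transpose $\xi_{i_a}=\varepsilon_{b_0}\cdot F(i_a):F(a)\to b_0$ is an isomorphism. $\mathbf{G}\text{-coalg}(b_0)$ is the set of all $\mathbf{G}$-coalgebra structures $\theta:b_0\to FU(b_0)$ on the object $b_0$. $F$ is comonadic if the comparison functor $K_{\mathbf{G}}:\mathcal{A}\to\mathcal{B}_{\mathbf{G}}$, $a\mapsto(F(a),F(\eta_a))$, into the Eilenberg–Moore category of $\mathbf{G}$-coalgebras is an equivalence of categories. *)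

theory Defs
  imports Main
begin

section \<open>Categories\<close>

record ('o, 'm) cat =
  Obj :: "'o set"
  Arr :: "'m set"
  Dom :: "'m \<Rightarrow> 'o"
  Cod :: "'m \<Rightarrow> 'o"
  Idn :: "'o \<Rightarrow> 'm"
  Cmp :: "'m \<Rightarrow> 'm \<Rightarrow> 'm"  (infixl "\<cdot>\<index>" 70)

definition Hom :: "('o, 'm) cat \<Rightarrow> 'o \<Rightarrow> 'o \<Rightarrow> 'm set" where
  "Hom C a b = {f \<in> Arr C. Dom C f = a \<and> Cod C f = b}"

locale category =
  fixes C :: "('o, 'm) cat" (structure)
  assumes Dom_Obj: "f \<in> Arr C \<Longrightarrow> Dom C f \<in> Obj C"
    and Cod_Obj: "f \<in> Arr C \<Longrightarrow> Cod C f \<in> Obj C"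
    and Idn_Hom: "a \<in> Obj C \<Longrightarrow> Idn C a \<in> Hom C a a"
    and Cmp_Hom: "f \<in> Hom C a b \<Longrightarrow> g \<in> Hom C b c \<Longrightarrow> g \<cdot> f \<in> Hom C a c"
    and Cmp_Idn: "f \<in> Hom C a b \<Longrightarrow> f \<cdot> Idn C a = f"
    and Idn_Cmp: "f \<in> Hom C a b \<Longrightarrow> Idn C b \<cdot> f = f"
    and Cmp_assoc: "f \<in> Hom C a b \<Longrightarrow> g \<in> Hom C b c \<Longrightarrow> h \<in> Hom C c d
      \<Longrightarrow> (h \<cdot> g) \<cdot> f = h \<cdot> (g \<cdot> f)"

definition monic :: "('o, 'm) cat \<Rightarrow> 'm \<Rightarrow> bool" where
  "monic C f \<longleftrightarrow> f \<in> Arr C \<and>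
    (\<forall>c. \<forall>g \<in> Hom C c (Dom C f). \<forall>h \<in> Hom C c (Dom C f).
      f \<cdot>\<^bsub>C\<^esub> g = f \<cdot>\<^bsub>C\<^esub> h \<longrightarrow> g = h)"

definition inverse_arrows :: "('o, 'm) cat \<Rightarrow> 'm \<Rightarrow> 'm \<Rightarrow> bool" where
  "inverse_arrows C f g \<longleftrightarrow> f \<in> Arr C \<and> g \<in> Hom C (Cod C f) (Dom C f) \<and>
    g \<cdot>\<^bsub>C\<^esub> f = Idn C (Dom C f) \<and> f \<cdot>\<^bsub>C\<^esub> g = Idn C (Cod C f)"

definition iso_arrow :: "('o, 'm) cat \<Rightarrow> 'm \<Rightarrow> bool" where
  "iso_arrow C f \<longleftrightarrow> (\<exists>g. inverse_arrows C f g)"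

definition inv_arrow :: "('o, 'm) cat \<Rightarrow> 'm \<Rightarrow> 'm" where
  "inv_arrow C f = (THE g. inverse_arrows C f g)"

section \<open>Functors, natural transformations, equivalences\<close>

record ('o1, 'm1, 'o2, 'm2) ftor =
  omap :: "'o1 \<Rightarrow> 'o2"
  amap :: "'m1 \<Rightarrow> 'm2"

locale cat_functor = A: category A + B: category B
  for A :: "('o1, 'm1) cat" and B :: "('o2, 'm2) cat" +
  fixes F :: "('o1, 'm1, 'o2, 'm2) ftor"
  assumes omap_Obj: "a \<in> Obj A \<Longrightarrow> omap F a \<in> Obj B"
    and amap_Hom: "f \<in> Hom A a a' \<Longrightarrow> amap F f \<in> Hom B (omap F a) (omap F a')"
    and amap_Idn: "a \<in> Obj A \<Longrightarrow> amap F (Idn A a) = Idn B (omap F a)"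
    and amap_Cmp: "f \<in> Hom A a a' \<Longrightarrow> g \<in> Hom A a' a''
      \<Longrightarrow> amap F (g \<cdot>\<^bsub>A\<^esub> f) = amap F g \<cdot>\<^bsub>B\<^esub> amap F f"

definition id_ftor :: "('o, 'm, 'o, 'm) ftor" where
  "id_ftor = \<lparr>omap = (\<lambda>a. a), amap = (\<lambda>f. f)\<rparr>"

definition comp_ftor ::
  "('o2, 'm2, 'o3, 'm3) ftor \<Rightarrow> ('o1, 'm1, 'o2, 'm2) ftor \<Rightarrow> ('o1, 'm1, 'o3, 'm3) ftor"
  (infixl "\<circ>\<^sub>F" 75) where
  "G \<circ>\<^sub>F F = \<lparr>omap = (\<lambda>a. omap G (omap F a)), amap = (\<lambda>f. amap G (amap F f))\<rparr>"

locale nat_trans = F: cat_functor A B F + G: cat_functor A B G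
  for A :: "('o1, 'm1) cat" and B :: "('o2, 'm2) cat"
    and F G :: "('o1, 'm1, 'o2, 'm2) ftor" +
  fixes \<tau> :: "'o1 \<Rightarrow> 'm2"
  assumes component: "a \<in> Obj A \<Longrightarrow> \<tau> a \<in> Hom B (omap F a) (omap G a)"
    and naturality: "f \<in> Hom A a a'
      \<Longrightarrow> \<tau> a' \<cdot>\<^bsub>B\<^esub> amap F f = amap G f \<cdot>\<^bsub>B\<^esub> \<tau> a"

definition nat_iso :: "('o1, 'm1) cat \<Rightarrow> ('o2, 'm2) cat \<Rightarrow> ('o1, 'm1, 'o2, 'm2) ftor
    \<Rightarrow> ('o1, 'm1, 'o2, 'm2) ftor \<Rightarrow> ('o1 \<Rightarrow> 'm2) \<Rightarrow> bool" where
  "nat_iso A B F G \<tau> \<longleftrightarrow> nat_trans A B F G \<tau> \<and> (\<forall>a \<in> Obj A. iso_arrow B (\<tau> a))"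

definition is_equivalence ::
  "('o1, 'm1) cat \<Rightarrow> ('o2, 'm2) cat \<Rightarrow> ('o1, 'm1, 'o2, 'm2) ftor \<Rightarrow> bool" where
  "is_equivalence A B K \<longleftrightarrow> cat_functor A B K \<and>
    (\<exists>L. cat_functor B A L \<and>
      (\<exists>\<sigma>. nat_iso A A id_ftor (L \<circ>\<^sub>F K) \<sigma>) \<and>
      (\<exists>\<tau>. nat_iso B B (K \<circ>\<^sub>F L) id_ftor \<tau>))"

section \<open>Adjunctions, comonads, coalgebras\<close>

locale adjunction =
  F: cat_functor A B F + U: cat_functor B A U +
  unit: nat_trans A A id_ftor "U \<circ>\<^sub>F F" \<eta> +
  counit: nat_trans B B "F \<circ>\<^sub>F U" id_ftor \<epsilon>
  for A :: "('o1, 'm1) cat" and B :: "('o2, 'm2) cat"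
    and F :: "('o1, 'm1, 'o2, 'm2) ftor" and U :: "('o2, 'm2, 'o1, 'm1) ftor"
    and \<eta> :: "'o1 \<Rightarrow> 'm1" and \<epsilon> :: "'o2 \<Rightarrow> 'm2" +
  assumes triangle_F: "a \<in> Obj A
      \<Longrightarrow> \<epsilon> (omap F a) \<cdot>\<^bsub>B\<^esub> amap F (\<eta> a) = Idn B (omap F a)"
    and triangle_U: "b \<in> Obj B
      \<Longrightarrow> amap U (\<epsilon> b) \<cdot>\<^bsub>A\<^esub> \<eta> (omap U b) = Idn A (omap U b)"

record ('o, 'm) comonad_data =
  endo :: "('o, 'm, 'o, 'm) ftor"
  counit :: "'o \<Rightarrow> 'm"
  comult :: "'o \<Rightarrow> 'm"

locale comonad =
  endo: cat_functor B B "endo G" +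
  counit: nat_trans B B "endo G" id_ftor "counit G" +
  comult: nat_trans B B "endo G" "endo G \<circ>\<^sub>F endo G" "comult G"
  for B :: "('o, 'm) cat" and G :: "('o, 'm) comonad_data" +
  assumes counit_left: "b \<in> Obj B
      \<Longrightarrow> counit G (omap (endo G) b) \<cdot>\<^bsub>B\<^esub> comult G b = Idn B (omap (endo G) b)"
    and counit_right: "b \<in> Obj B
      \<Longrightarrow> amap (endo G) (counit G b) \<cdot>\<^bsub>B\<^esub> comult G b = Idn B (omap (endo G) b)"
    and coassoc: "b \<in> Obj B
      \<Longrightarrow> comult G (omap (endo G) b) \<cdot>\<^bsub>B\<^esub> comult G b
        = amap (endo G) (comult G b) \<cdot>\<^bsub>B\<^esub> comult G b"

definition adj_comonad :: "('o1, 'm1, 'o2, 'm2) ftor \<Rightarrow> ('o2, 'm2, 'o1, 'm1) ftor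
    \<Rightarrow> ('o1 \<Rightarrow> 'm1) \<Rightarrow> ('o2 \<Rightarrow> 'm2) \<Rightarrow> ('o2, 'm2) comonad_data" where
  "adj_comonad F U \<eta> \<epsilon> =
    \<lparr>endo = F \<circ>\<^sub>F U, counit = \<epsilon>, comult = (\<lambda>b. amap F (\<eta> (omap U b)))\<rparr>"

lemma (in adjunction) comonad_adj_comonad: "comonad B (adj_comonad F U \<eta> \<epsilon>)"
proof -
  have e: "cat_functor B B (F \<circ>\<^sub>F U)"
    by (rule counit.F.cat_functor_axioms)
  have c: "nat_trans B B (F \<circ>\<^sub>F U) (F \<circ>\<^sub>F U \<circ>\<^sub>F (F \<circ>\<^sub>F U)) (\<lambda>b. amap F (\<eta> (omap U b)))"
  proof unfold_locales
    fix b assume "b \<in> Obj B"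
    then show "omap (F \<circ>\<^sub>F U \<circ>\<^sub>F (F \<circ>\<^sub>F U)) b \<in> Obj B"
      by (simp add: comp_ftor_def F.omap_Obj U.omap_Obj)
    show "amap F (\<eta> (omap U b)) \<in> Hom B (omap (F \<circ>\<^sub>F U) b) (omap (F \<circ>\<^sub>F U \<circ>\<^sub>F (F \<circ>\<^sub>F U)) b)"
      using unit.component[OF U.omap_Obj[OF \<open>b \<in> Obj B\<close>]] F.amap_Hom
      by (simp add: comp_ftor_def id_ftor_def)
    show "amap (F \<circ>\<^sub>F U \<circ>\<^sub>F (F \<circ>\<^sub>F U)) (Idn B b) = Idn B (omap (F \<circ>\<^sub>F U \<circ>\<^sub>F (F \<circ>\<^sub>F U)) b)"
      using \<open>b \<in> Obj B\<close>
      by (simp add: comp_ftor_def F.omap_Obj U.omap_Obj F.amap_Idn U.amap_Idn)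
  next
    fix f b b' assume f: "f \<in> Hom B b b'"
    show "amap (F \<circ>\<^sub>F U \<circ>\<^sub>F (F \<circ>\<^sub>F U)) f
        \<in> Hom B (omap (F \<circ>\<^sub>F U \<circ>\<^sub>F (F \<circ>\<^sub>F U)) b) (omap (F \<circ>\<^sub>F U \<circ>\<^sub>F (F \<circ>\<^sub>F U)) b')"
      using f by (simp add: comp_ftor_def F.amap_Hom U.amap_Hom)
    have b: "b \<in> Obj B" "b' \<in> Obj B"
      using f F.B.Dom_Obj F.B.Cod_Obj by (auto simp: Hom_def)
    have "\<eta> (omap U b') \<cdot>\<^bsub>A\<^esub> amap U f = amap U (amap F (amap U f)) \<cdot>\<^bsub>A\<^esub> \<eta> (omap U b)"
      using unit.naturality[OF U.amap_Hom[OF f]] by (simp add: comp_ftor_def id_ftor_def)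
    moreover have "\<eta> (omap U b) \<in> Hom A (omap U b) (omap U (omap F (omap U b)))"
      "\<eta> (omap U b') \<in> Hom A (omap U b') (omap U (omap F (omap U b')))"
      using b unit.component U.omap_Obj by (simp_all add: comp_ftor_def id_ftor_def)
    ultimately show "amap F (\<eta> (omap U b')) \<cdot>\<^bsub>B\<^esub> amap (F \<circ>\<^sub>F U) f =
        amap (F \<circ>\<^sub>F U \<circ>\<^sub>F (F \<circ>\<^sub>F U)) f \<cdot>\<^bsub>B\<^esub> amap F (\<eta> (omap U b))"
      using f by (simp add: comp_ftor_def)
        (metis F.amap_Cmp F.amap_Hom U.amap_Hom)
  next
    fix f b b' g b''
    assume "f \<in> Hom B b b'" "g \<in> Hom B b' b''"
    then show "amap (F \<circ>\<^sub>F U \<circ>\<^sub>F (F \<circ>\<^sub>F U)) (g \<cdot>\<^bsub>B\<^esub> f) =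
        amap (F \<circ>\<^sub>F U \<circ>\<^sub>F (F \<circ>\<^sub>F U)) g \<cdot>\<^bsub>B\<^esub> amap (F \<circ>\<^sub>F U \<circ>\<^sub>F (F \<circ>\<^sub>F U)) f"
      by (simp add: comp_ftor_def) (metis U.amap_Cmp F.amap_Cmp U.amap_Hom F.amap_Hom)
  qed
  show ?thesis
  proof (intro comonad.intro comonad_axioms.intro)
    show "cat_functor B B (endo (adj_comonad F U \<eta> \<epsilon>))"
      using e by (simp add: adj_comonad_def)
    show "nat_trans B B (endo (adj_comonad F U \<eta> \<epsilon>)) id_ftor (comonad_data.counit (adj_comonad F U \<eta> \<epsilon>))"
      using counit.nat_trans_axioms by (simp add: adj_comonad_def)
    show "nat_trans B B (endo (adj_comonad F U \<eta> \<epsilon>))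
       (endo (adj_comonad F U \<eta> \<epsilon>) \<circ>\<^sub>F endo (adj_comonad F U \<eta> \<epsilon>)) (comult (adj_comonad F U \<eta> \<epsilon>))"
      using c by (simp add: adj_comonad_def)
  next
    fix b assume b: "b \<in> Obj B"
    let ?\<eta> = "\<eta> (omap U b)"
    have h: "?\<eta> \<in> Hom A (omap U b) (omap U (omap F (omap U b)))"
      using b unit.component U.omap_Obj by (simp add: comp_ftor_def id_ftor_def)
    have eb: "amap U (\<epsilon> b) \<in> Hom A (omap U (omap F (omap U b))) (omap U b)"
      using b counit.component U.amap_Hom by (simp add: comp_ftor_def id_ftor_def)
    show "comonad_data.counit (adj_comonad F U \<eta> \<epsilon>) (omap (endo (adj_comonad F U \<eta> \<epsilon>)) b)
        \<cdot>\<^bsub>B\<^esub> comult (adj_comonad F U \<eta> \<epsilon>) b = Idn B (omap (endo (adj_comonad F U \<eta> \<epsilon>)) b)"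
      using b by (simp add: adj_comonad_def comp_ftor_def triangle_F U.omap_Obj)
    show "amap (endo (adj_comonad F U \<eta> \<epsilon>)) (comonad_data.counit (adj_comonad F U \<eta> \<epsilon>) b)
        \<cdot>\<^bsub>B\<^esub> comult (adj_comonad F U \<eta> \<epsilon>) b = Idn B (omap (endo (adj_comonad F U \<eta> \<epsilon>)) b)"
      using b F.amap_Cmp[OF h eb] triangle_U[OF b] F.amap_Idn[OF U.omap_Obj[OF b]]
      by (simp add: adj_comonad_def comp_ftor_def)
    show "comult (adj_comonad F U \<eta> \<epsilon>) (omap (endo (adj_comonad F U \<eta> \<epsilon>)) b)
          \<cdot>\<^bsub>B\<^esub> comult (adj_comonad F U \<eta> \<epsilon>) b =
        amap (endo (adj_comonad F U \<eta> \<epsilon>)) (comult (adj_comonad F U \<eta> \<epsilon>) b)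
          \<cdot>\<^bsub>B\<^esub> comult (adj_comonad F U \<eta> \<epsilon>) b"
    proof -
      have h2: "\<eta> (omap U (omap F (omap U b))) \<in> Hom A (omap U (omap F (omap U b)))
          (omap U (omap F (omap U (omap F (omap U b)))))"
        using b unit.component U.omap_Obj F.omap_Obj by (simp add: comp_ftor_def id_ftor_def)
      have "\<eta> (omap U (omap F (omap U b))) \<cdot>\<^bsub>A\<^esub> ?\<eta> = amap U (amap F ?\<eta>) \<cdot>\<^bsub>A\<^esub> ?\<eta>"
        using unit.naturality[OF h] by (simp add: comp_ftor_def id_ftor_def)
      then show ?thesis
        using F.amap_Cmp[OF h h2] F.amap_Cmp[OF h U.amap_Hom[OF F.amap_Hom[OF h]]]
        by (simp add: adj_comonad_def comp_ftor_def)
    qed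
  qed
qed

definition coalg_structures ::
  "('o, 'm) cat \<Rightarrow> ('o, 'm) comonad_data \<Rightarrow> 'o \<Rightarrow> 'm set" where
  "coalg_structures B G b = {\<theta> \<in> Hom B b (omap (endo G) b).
    counit G b \<cdot>\<^bsub>B\<^esub> \<theta> = Idn B b \<and>
    amap (endo G) \<theta> \<cdot>\<^bsub>B\<^esub> \<theta> = comult G b \<cdot>\<^bsub>B\<^esub> \<theta>}"

text \<open>The Eilenberg--Moore category of coalgebras. The same arrow of the base category may be
  a morphism between several pairs of coalgebras, so an arrow here is a triple: source
  coalgebra, underlying arrow, target coalgebra.\<close>

definition coalg_cat :: "('o, 'm) cat \<Rightarrow> ('o, 'm) comonad_data
    \<Rightarrow> ('o \<times> 'm, ('o \<times> 'm) \<times> 'm \<times> ('o \<times> 'm)) cat" where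
  "coalg_cat B G =
    \<lparr>Obj = {(b, \<theta>). b \<in> Obj B \<and> \<theta> \<in> coalg_structures B G b},
     Arr = {((b, \<theta>), f, (b', \<theta>')).
       b \<in> Obj B \<and> \<theta> \<in> coalg_structures B G b \<and>
       b' \<in> Obj B \<and> \<theta>' \<in> coalg_structures B G b' \<and>
       f \<in> Hom B b b' \<and> \<theta>' \<cdot>\<^bsub>B\<^esub> f = amap (endo G) f \<cdot>\<^bsub>B\<^esub> \<theta>},
     Dom = (\<lambda>(x, f, y). x),
     Cod = (\<lambda>(x, f, y). y),
     Idn = (\<lambda>(b, \<theta>). ((b, \<theta>), Idn B b, (b, \<theta>))),
     Cmp = (\<lambda>(y, g, z) (x, f, y'). (x, g \<cdot>\<^bsub>B\<^esub> f, z))\<rparr>"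

lemma (in comonad) category_coalg_cat: "category (coalg_cat B G)"
proof (rule category.intro)
  let ?C = "coalg_cat B G"
  fix f assume "f \<in> Arr ?C"
  then show "Dom ?C f \<in> Obj ?C" "Cod ?C f \<in> Obj ?C"
    by (auto simp: coalg_cat_def)
next
  let ?C = "coalg_cat B G"
  fix a assume "a \<in> Obj ?C"
  then obtain b \<theta> where a: "a = (b, \<theta>)" "b \<in> Obj B" "\<theta> \<in> coalg_structures B G b"
    by (auto simp: coalg_cat_def)
  then have "\<theta> \<in> Hom B b (omap (endo G) b)"
    by (simp add: coalg_structures_def)
  then show "Idn ?C a \<in> Hom ?C a a"
    using a unfolding Hom_def[of ?C]
    by (simp add: coalg_cat_def endo.A.Idn_Hom endo.amap_Idn endo.A.Cmp_Idn endo.A.Idn_Cmp)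
next
  let ?C = "coalg_cat B G"
  fix f g x y z assume f: "f \<in> Hom ?C x y" and g: "g \<in> Hom ?C y z"
  obtain b \<theta> b' \<theta>' b'' \<theta>'' u v where
    e: "x = (b, \<theta>)" "y = (b', \<theta>')" "z = (b'', \<theta>'')" "f = (x, u, y)" "g = (y, v, z)" and
    o: "b \<in> Obj B" "b' \<in> Obj B" "b'' \<in> Obj B" and
    t: "\<theta> \<in> coalg_structures B G b" "\<theta>' \<in> coalg_structures B G b'" "\<theta>'' \<in> coalg_structures B G b''" and
    u: "u \<in> Hom B b b'" "v \<in> Hom B b' b''" and
    c: "\<theta>' \<cdot>\<^bsub>B\<^esub> u = amap (endo G) u \<cdot>\<^bsub>B\<^esub> \<theta>" "\<theta>'' \<cdot>\<^bsub>B\<^esub> v = amap (endo G) v \<cdot>\<^bsub>B\<^esub> \<theta>'"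
    using f g unfolding Hom_def[of ?C] by (auto simp: coalg_cat_def)
  have h: "\<theta> \<in> Hom B b (omap (endo G) b)" "\<theta>' \<in> Hom B b' (omap (endo G) b')"
    "\<theta>'' \<in> Hom B b'' (omap (endo G) b'')"
    using t by (simp_all add: coalg_structures_def)
  have "\<theta>'' \<cdot>\<^bsub>B\<^esub> (v \<cdot>\<^bsub>B\<^esub> u) = (amap (endo G) v \<cdot>\<^bsub>B\<^esub> \<theta>') \<cdot>\<^bsub>B\<^esub> u"
    using endo.A.Cmp_assoc[OF u h(3)] c by simp
  also have "\<dots> = amap (endo G) v \<cdot>\<^bsub>B\<^esub> (amap (endo G) u \<cdot>\<^bsub>B\<^esub> \<theta>)"
    using endo.A.Cmp_assoc[OF u(1) h(2) endo.amap_Hom[OF u(2)]] c by simp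
  also have "\<dots> = amap (endo G) (v \<cdot>\<^bsub>B\<^esub> u) \<cdot>\<^bsub>B\<^esub> \<theta>"
    using endo.A.Cmp_assoc[OF h(1) endo.amap_Hom[OF u(1)] endo.amap_Hom[OF u(2)]]
      endo.amap_Cmp[OF u] by simp
  finally show "g \<cdot>\<^bsub>?C\<^esub> f \<in> Hom ?C x z"
    using e o t endo.A.Cmp_Hom[OF u] unfolding Hom_def[of ?C] by (simp add: coalg_cat_def)
next
  let ?C = "coalg_cat B G"
  fix f x y assume "f \<in> Hom ?C x y"
  then show "f \<cdot>\<^bsub>?C\<^esub> Idn ?C x = f" "Idn ?C y \<cdot>\<^bsub>?C\<^esub> f = f"
    unfolding Hom_def[of ?C] by (auto simp: coalg_cat_def endo.A.Cmp_Idn endo.A.Idn_Cmp)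
next
  let ?C = "coalg_cat B G"
  fix f g h x y z w
  assume "f \<in> Hom ?C x y" "g \<in> Hom ?C y z" "h \<in> Hom ?C z w"
  then show "(h \<cdot>\<^bsub>?C\<^esub> g) \<cdot>\<^bsub>?C\<^esub> f = h \<cdot>\<^bsub>?C\<^esub> (g \<cdot>\<^bsub>?C\<^esub> f)"
    unfolding Hom_def[of ?C] by (auto simp: coalg_cat_def endo.A.Cmp_assoc)
qed

definition comparison :: "('o1, 'm1) cat \<Rightarrow> ('o1, 'm1, 'o2, 'm2) ftor \<Rightarrow> ('o1 \<Rightarrow> 'm1)
    \<Rightarrow> ('o1, 'm1, 'o2 \<times> 'm2, ('o2 \<times> 'm2) \<times> 'm2 \<times> ('o2 \<times> 'm2)) ftor" where
  "comparison A F \<eta> =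
    \<lparr>omap = (\<lambda>a. (omap F a, amap F (\<eta> a))),
     amap = (\<lambda>f. ((omap F (Dom A f), amap F (\<eta> (Dom A f))), amap F f,
                  (omap F (Cod A f), amap F (\<eta> (Cod A f)))))\<rparr>"

lemma (in adjunction) cat_functor_comparison:
  "cat_functor A (coalg_cat B (adj_comonad F U \<eta> \<epsilon>)) (comparison A F \<eta>)"
proof -
  let ?G = "adj_comonad F U \<eta> \<epsilon>"
  let ?C = "coalg_cat B ?G"
  have h: "\<eta> a \<in> Hom A a (omap U (omap F a))" if "a \<in> Obj A" for a
    using unit.component[OF that] by (simp add: comp_ftor_def id_ftor_def)
  have n: "\<eta> a' \<cdot>\<^bsub>A\<^esub> f = amap U (amap F f) \<cdot>\<^bsub>A\<^esub> \<eta> a" if "f \<in> Hom A a a'" for f a a'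
    using unit.naturality[OF that] by (simp add: comp_ftor_def id_ftor_def)
  have t: "amap F (\<eta> a) \<in> coalg_structures B ?G (omap F a)" if a: "a \<in> Obj A" for a
  proof -
    have "amap F (amap U (amap F (\<eta> a))) \<cdot>\<^bsub>B\<^esub> amap F (\<eta> a) =
        amap F (\<eta> (omap U (omap F a))) \<cdot>\<^bsub>B\<^esub> amap F (\<eta> a)"
      using n[OF h[OF a]] F.amap_Cmp[OF h[OF a] U.amap_Hom[OF F.amap_Hom[OF h[OF a]]]]
        F.amap_Cmp[OF h[OF a] h[OF U.omap_Obj[OF F.omap_Obj[OF a]]]] by simp
    then show ?thesis
      using F.amap_Hom[OF h[OF a]] triangle_F[OF a]
      by (simp add: coalg_structures_def adj_comonad_def comp_ftor_def)
  qed
  interpret G: comonad B ?G by (rule comonad_adj_comonad)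
  interpret C: category ?C by (rule G.category_coalg_cat)
  show ?thesis
  proof unfold_locales
    fix a assume a: "a \<in> Obj A"
    then show "omap (comparison A F \<eta>) a \<in> Obj ?C"
      using t F.omap_Obj by (simp add: comparison_def coalg_cat_def)
    show "amap (comparison A F \<eta>) (Idn A a) = Idn ?C (omap (comparison A F \<eta>) a)"
      using F.A.Idn_Hom[OF a] F.amap_Idn[OF a] by (simp add: comparison_def coalg_cat_def Hom_def)
  next
    fix f a a' assume f: "f \<in> Hom A a a'"
    have a: "a \<in> Obj A" "a' \<in> Obj A" "Dom A f = a" "Cod A f = a'"
      using f F.A.Dom_Obj F.A.Cod_Obj by (auto simp: Hom_def)
    have "amap F (\<eta> a') \<cdot>\<^bsub>B\<^esub> amap F f = amap F (amap U (amap F f)) \<cdot>\<^bsub>B\<^esub> amap F (\<eta> a)"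
      using n[OF f] F.amap_Cmp[OF f h[OF a(2)]]
        F.amap_Cmp[OF h[OF a(1)] U.amap_Hom[OF F.amap_Hom[OF f]]] by simp
    then show "amap (comparison A F \<eta>) f
        \<in> Hom ?C (omap (comparison A F \<eta>) a) (omap (comparison A F \<eta>) a')"
      unfolding Hom_def[of ?C] using a t F.omap_Obj F.amap_Hom[OF f]
      by (simp add: comparison_def coalg_cat_def) (simp add: adj_comonad_def comp_ftor_def)
  next
    fix f a a' g a'' assume fg: "f \<in> Hom A a a'" "g \<in> Hom A a' a''"
    show "amap (comparison A F \<eta>) (g \<cdot>\<^bsub>A\<^esub> f) =
        amap (comparison A F \<eta>) g \<cdot>\<^bsub>?C\<^esub> amap (comparison A F \<eta>) f"
      using fg F.A.Cmp_Hom[OF fg] F.amap_Cmp[OF fg]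
      by (simp add: comparison_def coalg_cat_def Hom_def)
  qed
qed

definition comonadic :: "('o1, 'm1) cat \<Rightarrow> ('o2, 'm2) cat \<Rightarrow> ('o1, 'm1, 'o2, 'm2) ftor
    \<Rightarrow> ('o2, 'm2, 'o1, 'm1) ftor \<Rightarrow> ('o1 \<Rightarrow> 'm1) \<Rightarrow> ('o2 \<Rightarrow> 'm2) \<Rightarrow> bool" where
  "comonadic A B F U \<eta> \<epsilon> \<longleftrightarrow>
    is_equivalence A (coalg_cat B (adj_comonad F U \<eta> \<epsilon>)) (comparison A F \<eta>)"

section \<open>Subobjects\<close>

definition monos_into :: "('o, 'm) cat \<Rightarrow> 'o \<Rightarrow> ('o \<times> 'm) set" where
  "monos_into C x = {(a, i). i \<in> Hom C a x \<and> monic C i}"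

definition subobj_rel :: "('o, 'm) cat \<Rightarrow> 'o \<Rightarrow> (('o \<times> 'm) \<times> ('o \<times> 'm)) set" where
  "subobj_rel C x = {((a, i), (a', i')).
    (a, i) \<in> monos_into C x \<and> (a', i') \<in> monos_into C x \<and>
    (\<exists>k \<in> Hom C a a'. iso_arrow C k \<and> i = i' \<cdot>\<^bsub>C\<^esub> k)}"

definition subobj_class :: "('o, 'm) cat \<Rightarrow> 'o \<Rightarrow> 'o \<times> 'm \<Rightarrow> ('o \<times> 'm) set" where
  "subobj_class C x p = subobj_rel C x `` {p}"

section \<open>The map from subobjects to coalgebra structures\<close>

definition adj_transpose :: "('o2, 'm2) cat \<Rightarrow> ('o1, 'm1, 'o2, 'm2) ftor \<Rightarrow> ('o2 \<Rightarrow> 'm2)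
    \<Rightarrow> 'o2 \<Rightarrow> 'm1 \<Rightarrow> 'm2" where
  "adj_transpose B F \<epsilon> b i = \<epsilon> b \<cdot>\<^bsub>B\<^esub> amap F i"

definition Sub_reps :: "('o1, 'm1) cat \<Rightarrow> ('o2, 'm2) cat \<Rightarrow> ('o1, 'm1, 'o2, 'm2) ftor
    \<Rightarrow> ('o2, 'm2, 'o1, 'm1) ftor \<Rightarrow> ('o2 \<Rightarrow> 'm2) \<Rightarrow> 'o2 \<Rightarrow> ('o1 \<times> 'm1) set" where
  "Sub_reps A B F U \<epsilon> b =
    {(a, i) \<in> monos_into A (omap U b). iso_arrow B (adj_transpose B F \<epsilon> b i)}"

definition Sub_F :: "('o1, 'm1) cat \<Rightarrow> ('o2, 'm2) cat \<Rightarrow> ('o1, 'm1, 'o2, 'm2) ftor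
    \<Rightarrow> ('o2, 'm2, 'o1, 'm1) ftor \<Rightarrow> ('o2 \<Rightarrow> 'm2) \<Rightarrow> 'o2 \<Rightarrow> ('o1 \<times> 'm1) set set" where
  "Sub_F A B F U \<epsilon> b = subobj_class A (omap U b) ` Sub_reps A B F U \<epsilon> b"

definition Psi_rep :: "('o2, 'm2) cat \<Rightarrow> ('o1, 'm1, 'o2, 'm2) ftor
    \<Rightarrow> ('o2, 'm2, 'o1, 'm1) ftor \<Rightarrow> ('o1 \<Rightarrow> 'm1) \<Rightarrow> ('o2 \<Rightarrow> 'm2) \<Rightarrow> 'o2
    \<Rightarrow> 'o1 \<times> 'm1 \<Rightarrow> 'm2" where
  "Psi_rep B F U \<eta> \<epsilon> b = (\<lambda>(a, i).
    amap F (amap U (adj_transpose B F \<epsilon> b i)) \<cdot>\<^bsub>B\<^esub> amap F (\<eta> a)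
      \<cdot>\<^bsub>B\<^esub> inv_arrow B (adj_transpose B F \<epsilon> b i))"

text \<open>On a class whose members all have the same image under \<^const>\<open>Psi_rep\<close>, this is that
  common image; on any other set it is unspecified. Independence of the representative is
  therefore a separate claim.\<close>

definition Psi :: "('o2, 'm2) cat \<Rightarrow> ('o1, 'm1, 'o2, 'm2) ftor
    \<Rightarrow> ('o2, 'm2, 'o1, 'm1) ftor \<Rightarrow> ('o1 \<Rightarrow> 'm1) \<Rightarrow> ('o2 \<Rightarrow> 'm2) \<Rightarrow> 'o2
    \<Rightarrow> ('o1 \<times> 'm1) set \<Rightarrow> 'm2" where
  "Psi B F U \<eta> \<epsilon> b S = the_elem (Psi_rep B F U \<eta> \<epsilon> b ` S)"

end

theory Submission imports Defs begin

text \<open>Write \<open>\<xi>\<close> for the transpose of \<open>i : a \<rightarrow> U b\<close>. Since \<open>i = U \<xi> \<cdot> \<eta> a\<close>, the arrow that \<open>\<Psi>\<close> assigns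
  to \<open>i\<close> is \<open>F i \<cdot> \<xi>\<inverse>\<close>; in other words it is the only \<open>\<theta> : b \<rightarrow> F U b\<close> with \<open>\<theta> \<cdot> \<xi> = F i\<close>
  (lemma \<open>Psi_rep_eq_iff\<close>). That equation can also be read as
  \<open>\<theta> \<cdot> \<xi> = F U \<xi> \<cdot> F (\<eta> a)\<close>, which says that \<open>\<xi>\<close> is an isomorphism of coalgebras from
  \<open>K a = (F a, F (\<eta> a))\<close> to \<open>(b, \<theta>)\<close>. So \<open>\<Psi>\<close> transports the coalgebra structure of \<open>K a\<close> along
  \<open>\<xi>\<close>, and passing to transposes turns a representative \<open>(a, i)\<close> into an object \<open>a\<close> with an isomorphism of
  coalgebras from \<open>K a\<close> to some structure on \<open>b\<close>.

  From this point of view the theorem splits along the three properties of the equivalence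
  \<open>K\<close>. Essential surjectivity gives every \<open>(b, \<theta>)\<close> such an isomorphism, hence a preimage;
  faithfulness of \<open>K\<close>, that is of \<open>F\<close>, makes the resulting \<open>i\<close> monic, because cancelling \<open>i\<close>
  amounts after transposition to cancelling the isomorphism \<open>\<xi>\<close> and then \<open>F\<close>. Fullness gives
  injectivity: if \<open>i\<close> and \<open>i'\<close> have the same image \<open>\<theta>\<close>, then \<open>\<xi>'\<inverse> \<cdot> \<xi> : K a \<rightarrow> K a'\<close> is a
  morphism of coalgebras, so it is \<open>F k\<close> for some \<open>k\<close>, and transposing back shows
  \<open>i = i' \<cdot> k\<close>. Two monomorphisms that factor through each other represent the same
  subobject.\<close>

section \<open>Isomorphisms in a category\<close>

context category
begin

lemma Hom_Obj:
  assumes "f \<in> Hom C a b"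
  shows "a \<in> Obj C" "b \<in> Obj C"
  using assms Dom_Obj Cod_Obj by (auto simp: Hom_def)

lemma inverse_arrows_iff:
  assumes "f \<in> Hom C a b"
  shows "inverse_arrows C f g \<longleftrightarrow> g \<in> Hom C b a \<and> g \<cdot> f = Idn C a \<and> f \<cdot> g = Idn C b"
  using assms by (auto simp: inverse_arrows_def Hom_def)

lemma iso_arrowE:
  assumes "iso_arrow C f" "f \<in> Hom C a b"
  obtains g where "g \<in> Hom C b a" "g \<cdot> f = Idn C a" "f \<cdot> g = Idn C b"
  using assms inverse_arrows_iff unfolding iso_arrow_def by blast

lemma iso_arrowI:
  assumes "f \<in> Hom C a b" "g \<in> Hom C b a" "g \<cdot> f = Idn C a" "f \<cdot> g = Idn C b"
  shows "iso_arrow C f"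
  using assms inverse_arrows_iff unfolding iso_arrow_def by blast

lemma inv_arrow:
  assumes "iso_arrow C f" and f: "f \<in> Hom C a b"
  shows "inv_arrow C f \<in> Hom C b a" "inv_arrow C f \<cdot> f = Idn C a" "f \<cdot> inv_arrow C f = Idn C b"
proof -
  have "g = h" if g: "inverse_arrows C f g" and h: "inverse_arrows C f h" for g h
  proof -
    have g': "g \<in> Hom C b a" "g \<cdot> f = Idn C a" and h': "h \<in> Hom C b a" "f \<cdot> h = Idn C b"
      using g h inverse_arrows_iff[OF f] by auto
    have "g = g \<cdot> (f \<cdot> h)"
      using g' h' Cmp_Idn by simp
    also have "\<dots> = h"
      using Cmp_assoc[OF h'(1) f g'(1)] g' h' Idn_Cmp by simp
    finally show ?thesis .
  qed
  then have "inverse_arrows C f (inv_arrow C f)"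
    using assms(1) unfolding iso_arrow_def inv_arrow_def by (metis theI)
  then show "inv_arrow C f \<in> Hom C b a" "inv_arrow C f \<cdot> f = Idn C a"
    "f \<cdot> inv_arrow C f = Idn C b"
    using inverse_arrows_iff[OF f] by auto
qed

lemma iso_cancel_left:
  assumes "iso_arrow C f" and f: "f \<in> Hom C b c"
    and g: "g \<in> Hom C a b" and h: "h \<in> Hom C a b" and eq: "f \<cdot> g = f \<cdot> h"
  shows "g = h"
proof -
  note i = inv_arrow[OF assms(1) f]
  have "inv_arrow C f \<cdot> (f \<cdot> g) = g" "inv_arrow C f \<cdot> (f \<cdot> h) = h"
    using Cmp_assoc[OF g f i(1), symmetric] Cmp_assoc[OF h f i(1), symmetric] i(2) Idn_Cmp[OF g] Idn_Cmp[OF h]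
    by simp_all
  with eq show ?thesis by metis
qed

lemma iso_cancel_right:
  assumes "iso_arrow C f" and f: "f \<in> Hom C a b"
    and g: "g \<in> Hom C b c" and h: "h \<in> Hom C b c" and eq: "g \<cdot> f = h \<cdot> f"
  shows "g = h"
proof -
  note i = inv_arrow[OF assms(1) f]
  have "(g \<cdot> f) \<cdot> inv_arrow C f = g" "(h \<cdot> f) \<cdot> inv_arrow C f = h"
    using Cmp_assoc[OF i(1) f g] Cmp_assoc[OF i(1) f h] i(3) Cmp_Idn[OF g] Cmp_Idn[OF h]
    by simp_all
  with eq show ?thesis by metis
qed

lemma iso_arrow_Cmp:
  assumes "iso_arrow C f" and f: "f \<in> Hom C a b" and "iso_arrow C g" and g: "g \<in> Hom C b c"
  shows "iso_arrow C (g \<cdot> f)"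
proof (rule iso_arrowI)
  note i = inv_arrow[OF assms(1) f] and j = inv_arrow[OF assms(3) g]
  let ?i = "inv_arrow C f" and ?j = "inv_arrow C g"
  show gf: "g \<cdot> f \<in> Hom C a c" and ij: "?i \<cdot> ?j \<in> Hom C c a"
    using Cmp_Hom f g i j by blast+
  have "?j \<cdot> (g \<cdot> f) = f"
    using Cmp_assoc[OF f g j(1), symmetric] j Idn_Cmp[OF f] by simp
  then show "(?i \<cdot> ?j) \<cdot> (g \<cdot> f) = Idn C a"
    using Cmp_assoc[OF gf j(1) i(1)] i by simp
  have "f \<cdot> (?i \<cdot> ?j) = ?j"
    using Cmp_assoc[OF j(1) i(1) f, symmetric] i Idn_Cmp[OF j(1)] by simp
  then show "(g \<cdot> f) \<cdot> (?i \<cdot> ?j) = Idn C c"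
    using Cmp_assoc[OF ij f g] j by simp
qed

lemma monic_cancel:
  assumes "monic C f" "f \<in> Hom C b c" "g \<in> Hom C a b" "h \<in> Hom C a b" "f \<cdot> g = f \<cdot> h"
  shows "g = h"
  using assms unfolding monic_def Hom_def by blast

lemma subobj_relI:
  assumes i: "i \<in> Hom C a x" "monic C i" and j: "j \<in> Hom C b x" "monic C j"
    and k: "k \<in> Hom C a b" "i = j \<cdot> k" and l: "l \<in> Hom C b a" "j = i \<cdot> l"
  shows "((a, i), (b, j)) \<in> subobj_rel C x"
proof -
  have "i \<cdot> (l \<cdot> k) = i \<cdot> Idn C a" "j \<cdot> (k \<cdot> l) = j \<cdot> Idn C b"
    using Cmp_assoc[OF k(1) l(1) i(1)] Cmp_assoc[OF l(1) k(1) j(1)] k(2) l(2)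
      Cmp_Idn[OF i(1)] Cmp_Idn[OF j(1)]
    by metis+
  then have "l \<cdot> k = Idn C a" "k \<cdot> l = Idn C b"
    using monic_cancel[OF i(2,1)] monic_cancel[OF j(2,1)] Cmp_Hom[OF k(1) l(1)]
      Cmp_Hom[OF l(1) k(1)] Idn_Hom Hom_Obj[OF k(1)] by auto
  then have "iso_arrow C k"
    using iso_arrowI k(1) l(1) by blast
  then show ?thesis
    using i j k unfolding subobj_rel_def monos_into_def by auto
qed

lemma equiv_subobj_rel: "equiv (monos_into C x) (subobj_rel C x)"
proof (rule equivI)
  show "subobj_rel C x \<subseteq> monos_into C x \<times> monos_into C x"
    by (auto simp: subobj_rel_def)
  show "refl_on (monos_into C x) (subobj_rel C x)"
  proof (rule refl_onI)
    fix p assume "p \<in> monos_into C x"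
    then obtain a i where p: "p = (a, i)" "i \<in> Hom C a x" "monic C i"
      by (auto simp: monos_into_def)
    then show "(p, p) \<in> subobj_rel C x"
      using subobj_relI[of i a x i a "Idn C a" "Idn C a"] Hom_Obj Idn_Hom Cmp_Idn by auto
  qed
  show "sym (subobj_rel C x)"
  proof (rule symI)
    fix p q assume "(p, q) \<in> subobj_rel C x"
    then obtain a i b j k where p: "p = (a, i)" "q = (b, j)"
      and i: "i \<in> Hom C a x" "monic C i" and j: "j \<in> Hom C b x" "monic C j"
      and k: "k \<in> Hom C a b" "iso_arrow C k" "i = j \<cdot> k"
      by (auto simp: subobj_rel_def monos_into_def)
    note l = inv_arrow[OF k(2,1)]
    have "j = i \<cdot> inv_arrow C k"
      using Cmp_assoc[OF l(1) k(1) j(1)] k(3) l(3) Cmp_Idn[OF j(1)] by simp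
    then show "(q, p) \<in> subobj_rel C x"
      using subobj_relI[OF j i l(1) _ k(1,3)] p by simp
  qed
  show "trans (subobj_rel C x)"
  proof (rule transI)
    fix p q r assume "(p, q) \<in> subobj_rel C x" "(q, r) \<in> subobj_rel C x"
    then obtain a i b j c m k l where p: "p = (a, i)" "q = (b, j)" "r = (c, m)"
      and mem: "p \<in> monos_into C x" "r \<in> monos_into C x" and m: "m \<in> Hom C c x"
      and k: "k \<in> Hom C a b" "iso_arrow C k" "i = j \<cdot> k"
      and l: "l \<in> Hom C b c" "iso_arrow C l" "j = m \<cdot> l"
      by (auto simp: subobj_rel_def monos_into_def)
    then show "(p, r) \<in> subobj_rel C x"
      using Cmp_assoc[OF k(1) l(1) m] Cmp_Hom[OF k(1) l(1)] iso_arrow_Cmp[OF k(2,1) l(2,1)]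
      unfolding subobj_rel_def by auto
  qed
qed

end

lemma (in cat_functor) iso_arrow_amap:
  assumes "iso_arrow A f" "f \<in> Hom A a b"
  shows "iso_arrow B (amap F f)"
proof -
  note i = A.inv_arrow[OF assms]
  note ab = A.Hom_Obj[OF assms(2)]
  show ?thesis
  proof (rule B.iso_arrowI)
    show "amap F f \<in> Hom B (omap F a) (omap F b)"
      "amap F (inv_arrow A f) \<in> Hom B (omap F b) (omap F a)"
      using amap_Hom assms(2) i(1) by blast+
    show "amap F (inv_arrow A f) \<cdot>\<^bsub>B\<^esub> amap F f = Idn B (omap F a)"
      "amap F f \<cdot>\<^bsub>B\<^esub> amap F (inv_arrow A f) = Idn B (omap F b)"
      using amap_Cmp[OF assms(2) i(1)] amap_Cmp[OF i(1) assms(2)] i amap_Idn ab by simp_all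
  qed
qed

section \<open>Equivalences are full and faithful\<close>

text \<open>Naturality makes \<open>f\<close> a conjugate of \<open>L (K f)\<close>, so \<open>K f\<close> determines \<open>f\<close>. The counit version
  applies the same argument to the quasi-inverse \<open>L\<close>; its isomorphism points the other way, so
  the cancellation is on the other side.\<close>

lemma faithful_if_unit_iso:
  assumes L: "cat_functor B A L" and K: "cat_functor A B K"
    and iso: "nat_iso A A id_ftor (L \<circ>\<^sub>F K) \<sigma>"
    and f: "f \<in> Hom A a a'" and g: "g \<in> Hom A a a'" and eq: "amap K f = amap K g"
  shows "f = g"
proof -
  interpret nat_trans A A id_ftor "L \<circ>\<^sub>F K" \<sigma>
    using iso by (simp add: nat_iso_def)
  have a': "a' \<in> Obj A" using F.A.Hom_Obj[OF f] by simp
  have "\<sigma> a' \<cdot>\<^bsub>A\<^esub> f = \<sigma> a' \<cdot>\<^bsub>A\<^esub> g"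
    using naturality[OF f] naturality[OF g] eq by (simp add: id_ftor_def comp_ftor_def)
  moreover have "iso_arrow A (\<sigma> a')"
    using iso a' by (simp add: nat_iso_def)
  moreover have "\<sigma> a' \<in> Hom A a' (omap L (omap K a'))"
    using component[OF a'] by (simp add: id_ftor_def comp_ftor_def)
  ultimately show ?thesis
    using F.A.iso_cancel_left f g by blast
qed

lemma faithful_if_counit_iso:
  assumes L: "cat_functor B A L" and K: "cat_functor A B K"
    and iso: "nat_iso B B (K \<circ>\<^sub>F L) id_ftor \<tau>"
    and f: "f \<in> Hom B b b'" and g: "g \<in> Hom B b b'" and eq: "amap L f = amap L g"
  shows "f = g"
proof -
  interpret nat_trans B B "K \<circ>\<^sub>F L" id_ftor \<tau>
    using iso by (simp add: nat_iso_def)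
  have b: "b \<in> Obj B" using F.A.Hom_Obj[OF f] by simp
  have "f \<cdot>\<^bsub>B\<^esub> \<tau> b = g \<cdot>\<^bsub>B\<^esub> \<tau> b"
    using naturality[OF f] naturality[OF g] eq by (simp add: id_ftor_def comp_ftor_def)
  moreover have "iso_arrow B (\<tau> b)"
    using iso b by (simp add: nat_iso_def)
  moreover have "\<tau> b \<in> Hom B (omap K (omap L b)) b"
    using component[OF b] by (simp add: id_ftor_def comp_ftor_def)
  ultimately show ?thesis
    using F.A.iso_cancel_right f g by blast
qed

lemma equivalence_faithful:
  assumes "is_equivalence A B K" "f \<in> Hom A a a'" "g \<in> Hom A a a'" "amap K f = amap K g"
  shows "f = g"
  using assms faithful_if_unit_iso unfolding is_equivalence_def by metis

text \<open>The preimage of \<open>u\<close> is \<open>L u\<close> conjugated by \<open>\<sigma>\<close>; only \<open>L (K k) = L u\<close> is immediate from this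
  choice, and faithfulness of the quasi-inverse \<open>L\<close> removes the outer \<open>L\<close>.\<close>

lemma equivalence_full:
  assumes "is_equivalence A B K" and a: "a \<in> Obj A" "a' \<in> Obj A"
    and u: "u \<in> Hom B (omap K a) (omap K a')"
  obtains k where "k \<in> Hom A a a'" "amap K k = u"
proof -
  obtain L \<sigma> \<tau> where K: "cat_functor A B K" and L: "cat_functor B A L"
    and \<sigma>: "nat_iso A A id_ftor (L \<circ>\<^sub>F K) \<sigma>" and \<tau>: "nat_iso B B (K \<circ>\<^sub>F L) id_ftor \<tau>"
    using assms(1) unfolding is_equivalence_def by blast
  interpret K: cat_functor A B K by (rule K)
  interpret L: cat_functor B A L by (rule L)
  interpret nat_trans A A id_ftor "L \<circ>\<^sub>F K" \<sigma>
    using \<sigma> by (simp add: nat_iso_def)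
  have s: "\<sigma> x \<in> Hom A x (omap L (omap K x))" "iso_arrow A (\<sigma> x)" if "x \<in> Obj A" for x
    using component[OF that] \<sigma> that by (simp_all add: id_ftor_def comp_ftor_def nat_iso_def)
  note s1 = s[OF a(1)] and s2 = s[OF a(2)]
  note i = K.A.inv_arrow[OF s2(2,1)]
  let ?Lu = "amap L u"
  let ?k = "inv_arrow A (\<sigma> a') \<cdot>\<^bsub>A\<^esub> (?Lu \<cdot>\<^bsub>A\<^esub> \<sigma> a)"
  have Lu: "?Lu \<in> Hom A (omap L (omap K a)) (omap L (omap K a'))"
    using L.amap_Hom[OF u] .
  have Lus: "?Lu \<cdot>\<^bsub>A\<^esub> \<sigma> a \<in> Hom A a (omap L (omap K a'))"
    using K.A.Cmp_Hom[OF s1(1) Lu] .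
  have k: "?k \<in> Hom A a a'"
    using K.A.Cmp_Hom[OF Lus i(1)] .
  have "amap L (amap K ?k) \<cdot>\<^bsub>A\<^esub> \<sigma> a = \<sigma> a' \<cdot>\<^bsub>A\<^esub> ?k"
    using naturality[OF k] by (simp add: id_ftor_def comp_ftor_def)
  also have "\<dots> = ?Lu \<cdot>\<^bsub>A\<^esub> \<sigma> a"
    using K.A.Cmp_assoc[OF Lus i(1) s2(1), symmetric] i(3) K.A.Idn_Cmp[OF Lus] by simp
  finally have "amap L (amap K ?k) = ?Lu"
    using K.A.iso_cancel_right[OF s1(2,1)] Lu L.amap_Hom[OF K.amap_Hom[OF k]] by blast
  then have "amap K ?k = u"
    using faithful_if_counit_iso[OF L K \<tau> K.amap_Hom[OF k] u] by simp
  with k show thesis by (rule that)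
qed

lemma equivalence_essentially_surjective:
  assumes "is_equivalence A B K" "b \<in> Obj B"
  obtains a h where "a \<in> Obj A" "h \<in> Hom B (omap K a) b" "iso_arrow B h"
proof -
  obtain L \<tau> where L: "cat_functor B A L" and \<tau>: "nat_iso B B (K \<circ>\<^sub>F L) id_ftor \<tau>"
    using assms(1) unfolding is_equivalence_def by blast
  interpret nat_trans B B "K \<circ>\<^sub>F L" id_ftor \<tau>
    using \<tau> by (simp add: nat_iso_def)
  have "omap L b \<in> Obj A"
    using cat_functor.omap_Obj[OF L assms(2)] .
  moreover have "\<tau> b \<in> Hom B (omap K (omap L b)) b"
    using component[OF assms(2)] by (simp add: id_ftor_def comp_ftor_def)
  moreover have "iso_arrow B (\<tau> b)"
    using \<tau> assms(2) by (simp add: nat_iso_def)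
  ultimately show thesis by (rule that)
qed

section \<open>Transposes and the coalgebra structures they induce\<close>

context adjunction
begin

abbreviation "\<xi> \<equiv> adj_transpose B F \<epsilon>"
abbreviation "G \<equiv> adj_comonad F U \<eta> \<epsilon>"

lemma unit_Hom: "a \<in> Obj A \<Longrightarrow> \<eta> a \<in> Hom A a (omap U (omap F a))"
  using unit.component by (simp add: comp_ftor_def id_ftor_def)

lemma unit_natural:
  "f \<in> Hom A a a' \<Longrightarrow> \<eta> a' \<cdot>\<^bsub>A\<^esub> f = amap U (amap F f) \<cdot>\<^bsub>A\<^esub> \<eta> a"
  using unit.naturality by (simp add: comp_ftor_def id_ftor_def)

lemma counit_Hom: "b \<in> Obj B \<Longrightarrow> \<epsilon> b \<in> Hom B (omap F (omap U b)) b"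
  using counit.component by (simp add: comp_ftor_def id_ftor_def)

lemma counit_natural:
  "f \<in> Hom B b b' \<Longrightarrow> \<epsilon> b' \<cdot>\<^bsub>B\<^esub> amap F (amap U f) = f \<cdot>\<^bsub>B\<^esub> \<epsilon> b"
  using counit.naturality by (simp add: comp_ftor_def id_ftor_def)

lemma transpose_Hom:
  assumes "b \<in> Obj B" "i \<in> Hom A a (omap U b)"
  shows "\<xi> b i \<in> Hom B (omap F a) b"
  unfolding adj_transpose_def
  using F.B.Cmp_Hom[OF F.amap_Hom[OF assms(2)] counit_Hom[OF assms(1)]] .

lemma transpose_Cmp:
  assumes "b \<in> Obj B" "k \<in> Hom A a a'" "i \<in> Hom A a' (omap U b)"
  shows "\<xi> b (i \<cdot>\<^bsub>A\<^esub> k) = \<xi> b i \<cdot>\<^bsub>B\<^esub> amap F k"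
  unfolding adj_transpose_def
  using F.amap_Cmp[OF assms(2,3)]
    F.B.Cmp_assoc[OF F.amap_Hom[OF assms(2)] F.amap_Hom[OF assms(3)] counit_Hom[OF assms(1)]]
  by simp

lemma amap_U_transpose:
  assumes b: "b \<in> Obj B" and i: "i \<in> Hom A a (omap U b)"
  shows "amap U (\<xi> b i) \<cdot>\<^bsub>A\<^esub> \<eta> a = i"
proof -
  note a = F.A.Hom_Obj(1)[OF i]
  note Ub = U.omap_Obj[OF b]
  note e = counit_Hom[OF b] and Fi = F.amap_Hom[OF i]
  have "amap U (\<xi> b i) \<cdot>\<^bsub>A\<^esub> \<eta> a = amap U (\<epsilon> b) \<cdot>\<^bsub>A\<^esub> (amap U (amap F i) \<cdot>\<^bsub>A\<^esub> \<eta> a)"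
    unfolding adj_transpose_def
    using U.amap_Cmp[OF Fi e] F.A.Cmp_assoc[OF unit_Hom[OF a] U.amap_Hom[OF Fi] U.amap_Hom[OF e]]
    by simp
  also have "\<dots> = (amap U (\<epsilon> b) \<cdot>\<^bsub>A\<^esub> \<eta> (omap U b)) \<cdot>\<^bsub>A\<^esub> i"
    using unit_natural[OF i] F.A.Cmp_assoc[OF i unit_Hom[OF Ub] U.amap_Hom[OF e]] by simp
  also have "\<dots> = i"
    using triangle_U[OF b] F.A.Idn_Cmp[OF i] by simp
  finally show ?thesis .
qed

lemma transpose_amap_U:
  assumes a: "a \<in> Obj A" and h: "h \<in> Hom B (omap F a) b"
  shows "\<xi> b (amap U h \<cdot>\<^bsub>A\<^esub> \<eta> a) = h"
proof -
  note b = F.B.Hom_Obj(2)[OF h]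
  note Fa = F.omap_Obj[OF a]
  note n = unit_Hom[OF a] and Uh = U.amap_Hom[OF h]
  have "\<xi> b (amap U h \<cdot>\<^bsub>A\<^esub> \<eta> a) = (\<epsilon> b \<cdot>\<^bsub>B\<^esub> amap F (amap U h)) \<cdot>\<^bsub>B\<^esub> amap F (\<eta> a)"
    using transpose_Cmp[OF b n Uh] by (simp add: adj_transpose_def)
  also have "\<dots> = h \<cdot>\<^bsub>B\<^esub> (\<epsilon> (omap F a) \<cdot>\<^bsub>B\<^esub> amap F (\<eta> a))"
    using counit_natural[OF h] F.B.Cmp_assoc[OF F.amap_Hom[OF n] counit_Hom[OF Fa] h] by simp
  also have "\<dots> = h"
    using triangle_F[OF a] F.B.Cmp_Idn[OF h] by simp
  finally show ?thesis .
qed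

lemma amap_F_transpose:
  assumes "b \<in> Obj B" "i \<in> Hom A a (omap U b)"
  shows "amap F (amap U (\<xi> b i)) \<cdot>\<^bsub>B\<^esub> amap F (\<eta> a) = amap F i"
  using F.amap_Cmp[OF unit_Hom[OF F.A.Hom_Obj(1)[OF assms(2)]]
      U.amap_Hom[OF transpose_Hom[OF assms]]] amap_U_transpose[OF assms] by simp

text \<open>This characterization replaces the formula for the value of \<open>\<Psi>\<close>: identities about that
  value are proved by cancelling \<open>\<xi>\<close> on the right, without computing with \<open>\<xi>\<inverse>\<close>.\<close>

lemma Psi_rep_eq_iff:
  assumes b: "b \<in> Obj B" and i: "i \<in> Hom A a (omap U b)" and iso: "iso_arrow B (\<xi> b i)"
    and t: "\<theta> \<in> Hom B b (omap F (omap U b))"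
  shows "Psi_rep B F U \<eta> \<epsilon> b (a, i) = \<theta> \<longleftrightarrow> \<theta> \<cdot>\<^bsub>B\<^esub> \<xi> b i = amap F i"
proof -
  note x = transpose_Hom[OF b i] and Fi = F.amap_Hom[OF i]
  note v = F.B.inv_arrow[OF iso x]
  have P: "Psi_rep B F U \<eta> \<epsilon> b (a, i) = amap F i \<cdot>\<^bsub>B\<^esub> inv_arrow B (\<xi> b i)"
    using amap_F_transpose[OF b i] by (simp add: Psi_rep_def)
  have "(amap F i \<cdot>\<^bsub>B\<^esub> inv_arrow B (\<xi> b i)) \<cdot>\<^bsub>B\<^esub> \<xi> b i = amap F i"
    using F.B.Cmp_assoc[OF x v(1) Fi] v(2) F.B.Cmp_Idn[OF Fi] by simp
  then show ?thesis
    using P F.B.iso_cancel_right[OF iso x] F.B.Cmp_Hom[OF v(1) Fi] t by metis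
qed

lemma Psi_rep:
  assumes b: "b \<in> Obj B" and i: "i \<in> Hom A a (omap U b)" and iso: "iso_arrow B (\<xi> b i)"
  shows "Psi_rep B F U \<eta> \<epsilon> b (a, i) \<in> Hom B b (omap F (omap U b))"
    and "Psi_rep B F U \<eta> \<epsilon> b (a, i) \<cdot>\<^bsub>B\<^esub> \<xi> b i = amap F i"
proof -
  show *: "Psi_rep B F U \<eta> \<epsilon> b (a, i) \<in> Hom B b (omap F (omap U b))"
    using F.B.Cmp_Hom[OF F.B.inv_arrow(1)[OF iso transpose_Hom[OF b i]] F.amap_Hom[OF i]]
      amap_F_transpose[OF b i] by (simp add: Psi_rep_def)
  show "Psi_rep B F U \<eta> \<epsilon> b (a, i) \<cdot>\<^bsub>B\<^esub> \<xi> b i = amap F i"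
    using Psi_rep_eq_iff[OF b i iso *] by simp
qed

text \<open>Both coalgebra laws for \<open>\<theta>\<close> hold after composing with \<open>\<xi>\<close>, where they become the definition
  of \<open>\<xi>\<close> and the naturality of \<open>\<eta>\<close> at \<open>i\<close>.\<close>

lemma Psi_rep_coalg:
  assumes b: "b \<in> Obj B" and i: "i \<in> Hom A a (omap U b)" and iso: "iso_arrow B (\<xi> b i)"
  shows "Psi_rep B F U \<eta> \<epsilon> b (a, i) \<in> coalg_structures B G b"
proof -
  let ?t = "Psi_rep B F U \<eta> \<epsilon> b (a, i)" and ?x = "\<xi> b i"
  note x = transpose_Hom[OF b i] and Fi = F.amap_Hom[OF i]
  note t = Psi_rep[OF b i iso]
  note a = F.A.Hom_Obj(1)[OF i]
  note Ub = U.omap_Obj[OF b]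
  note e = counit_Hom[OF b] and n = unit_Hom[OF Ub]
  note Ut = U.amap_Hom[OF t(1)]
  note Fn = F.amap_Hom[OF n] and FUt = F.amap_Hom[OF Ut]
  have "(\<epsilon> b \<cdot>\<^bsub>B\<^esub> ?t) \<cdot>\<^bsub>B\<^esub> ?x = Idn B b \<cdot>\<^bsub>B\<^esub> ?x"
    using F.B.Cmp_assoc[OF x t(1) e] t(2) F.B.Idn_Cmp[OF x] by (simp add: adj_transpose_def)
  then have law1: "\<epsilon> b \<cdot>\<^bsub>B\<^esub> ?t = Idn B b"
    using F.B.iso_cancel_right[OF iso x] F.B.Cmp_Hom[OF t(1) e] F.B.Idn_Hom[OF b] by blast
  have "amap U ?t \<cdot>\<^bsub>A\<^esub> i = amap U ?t \<cdot>\<^bsub>A\<^esub> (amap U ?x \<cdot>\<^bsub>A\<^esub> \<eta> a)"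
    using amap_U_transpose[OF b i] by simp
  also have "\<dots> = amap U (amap F i) \<cdot>\<^bsub>A\<^esub> \<eta> a"
    using F.A.Cmp_assoc[OF unit_Hom[OF a] U.amap_Hom[OF x] Ut] U.amap_Cmp[OF x t(1)] t(2) by simp
  also have "\<dots> = \<eta> (omap U b) \<cdot>\<^bsub>A\<^esub> i"
    using unit_natural[OF i] by simp
  finally have "amap F (amap U ?t) \<cdot>\<^bsub>B\<^esub> amap F i = amap F (\<eta> (omap U b)) \<cdot>\<^bsub>B\<^esub> amap F i"
    using F.amap_Cmp[OF i Ut] F.amap_Cmp[OF i n] by simp
  then have "(amap F (amap U ?t) \<cdot>\<^bsub>B\<^esub> ?t) \<cdot>\<^bsub>B\<^esub> ?x = (amap F (\<eta> (omap U b)) \<cdot>\<^bsub>B\<^esub> ?t) \<cdot>\<^bsub>B\<^esub> ?x"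
    using F.B.Cmp_assoc[OF x t(1) FUt] F.B.Cmp_assoc[OF x t(1) Fn] t(2) by simp
  then have law2: "amap F (amap U ?t) \<cdot>\<^bsub>B\<^esub> ?t = amap F (\<eta> (omap U b)) \<cdot>\<^bsub>B\<^esub> ?t"
    using F.B.iso_cancel_right[OF iso x] F.B.Cmp_Hom[OF t(1) FUt] F.B.Cmp_Hom[OF t(1) Fn] by blast
  from law1 law2 t(1) show ?thesis
    by (simp add: coalg_structures_def adj_comonad_def comp_ftor_def)
qed

section \<open>Independence of the representative\<close>

text \<open>\<^const>\<open>Psi\<close> is specified only on sets on which \<^const>\<open>Psi_rep\<close> is constant. So the whole
  class has to be considered, including members that are not given as elements of
  \<^const>\<open>Sub_reps\<close>: their transposes are isomorphisms as well.\<close>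

lemma Psi_rep_subobj_rel:
  assumes b: "b \<in> Obj B" and r: "(a, i) \<in> Sub_reps A B F U \<epsilon> b"
    and rel: "((a, i), (a', i')) \<in> subobj_rel A (omap U b)"
  shows "Psi_rep B F U \<eta> \<epsilon> b (a', i') = Psi_rep B F U \<eta> \<epsilon> b (a, i)"
proof -
  have i: "i \<in> Hom A a (omap U b)" and iso: "iso_arrow B (\<xi> b i)"
    using r by (auto simp: Sub_reps_def monos_into_def)
  have "((a', i'), (a, i)) \<in> subobj_rel A (omap U b)"
    using F.A.equiv_subobj_rel rel by (blast elim: equivE dest: symD)
  then obtain l where l: "l \<in> Hom A a' a" "iso_arrow A l" "i' = i \<cdot>\<^bsub>A\<^esub> l"
    unfolding subobj_rel_def by blast
  have i': "i' \<in> Hom A a' (omap U b)"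
    using F.A.Cmp_Hom[OF l(1) i] l(3) by simp
  note x = transpose_Hom[OF b i] and Fl = F.amap_Hom[OF l(1)]
  note t = Psi_rep[OF b i iso]
  have x': "\<xi> b i' = \<xi> b i \<cdot>\<^bsub>B\<^esub> amap F l"
    using transpose_Cmp[OF b l(1) i] l(3) by simp
  then have iso': "iso_arrow B (\<xi> b i')"
    using F.B.iso_arrow_Cmp[OF F.iso_arrow_amap[OF l(2,1)] Fl iso x] by simp
  have "Psi_rep B F U \<eta> \<epsilon> b (a, i) \<cdot>\<^bsub>B\<^esub> \<xi> b i' = amap F i'"
    using F.B.Cmp_assoc[OF Fl x t(1)] x' t(2) F.amap_Cmp[OF l(1) i] l(3) by simp
  then show ?thesis
    using Psi_rep_eq_iff[OF b i' iso' t(1)] by simp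
qed

lemma Psi_subobj_class:
  assumes b: "b \<in> Obj B" and r: "p \<in> Sub_reps A B F U \<epsilon> b"
  shows "Psi B F U \<eta> \<epsilon> b (subobj_class A (omap U b) p) = Psi_rep B F U \<eta> \<epsilon> b p"
proof -
  let ?S = "subobj_class A (omap U b) p"
  have "p \<in> monos_into A (omap U b)"
    using r by (auto simp: Sub_reps_def)
  then have "p \<in> ?S"
    using equiv_class_self[OF F.A.equiv_subobj_rel] unfolding subobj_class_def by blast
  moreover have "Psi_rep B F U \<eta> \<epsilon> b q = Psi_rep B F U \<eta> \<epsilon> b p" if "q \<in> ?S" for q
    using that Psi_rep_subobj_rel[OF b, of "fst p" "snd p" "fst q" "snd q"] r
    by (simp add: subobj_class_def)
  ultimately show ?thesis
    unfolding Psi_def by (blast intro: the_elem_image_unique)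
qed

section \<open>Bijectivity when the left adjoint is comonadic\<close>

lemma comonadic_faithful:
  assumes "comonadic A B F U \<eta> \<epsilon>" "f \<in> Hom A a a'" "g \<in> Hom A a a'" "amap F f = amap F g"
  shows "f = g"
proof (rule equivalence_faithful[OF _ assms(2,3)])
  show "is_equivalence A (coalg_cat B G) (comparison A F \<eta>)"
    using assms(1) by (simp add: comonadic_def)
  show "amap (comparison A F \<eta>) f = amap (comparison A F \<eta>) g"
    using assms(2-4) by (simp add: comparison_def Hom_def)
qed

lemma comonadic_full:
  assumes com: "comonadic A B F U \<eta> \<epsilon>" and a: "a \<in> Obj A" "a' \<in> Obj A"
    and u: "u \<in> Hom B (omap F a) (omap F a')"
    and eq: "amap F (\<eta> a') \<cdot>\<^bsub>B\<^esub> u = amap F (amap U u) \<cdot>\<^bsub>B\<^esub> amap F (\<eta> a)"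
  obtains k where "k \<in> Hom A a a'" "amap F k = u"
proof -
  let ?C = "coalg_cat B G" and ?K = "comparison A F \<eta>"
  have eqv: "is_equivalence A ?C ?K"
    using com by (simp add: comonadic_def)
  interpret K: cat_functor A ?C ?K by (rule cat_functor_comparison)
  have "(omap ?K a, u, omap ?K a') \<in> Hom ?C (omap ?K a) (omap ?K a')"
    using K.omap_Obj[OF a(1)] K.omap_Obj[OF a(2)] u eq unfolding Hom_def[of ?C]
    by (simp add: coalg_cat_def comparison_def) (simp add: adj_comonad_def comp_ftor_def)
  then obtain k where "k \<in> Hom A a a'" "amap ?K k = (omap ?K a, u, omap ?K a')"
    using equivalence_full[OF eqv a] by blast
  then show thesis
    using that by (simp add: comparison_def)
qed

lemma coalg_iso_underlying:
  assumes h: "h \<in> Hom (coalg_cat B G) (b, \<theta>) (b', \<theta>')" and iso: "iso_arrow (coalg_cat B G) h"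
  obtains u where "u \<in> Hom B b b'" "iso_arrow B u"
    "\<theta>' \<cdot>\<^bsub>B\<^esub> u = amap F (amap U u) \<cdot>\<^bsub>B\<^esub> \<theta>"
proof -
  let ?C = "coalg_cat B G"
  interpret C: category ?C
    by (rule comonad.category_coalg_cat[OF comonad_adj_comonad])
  obtain g where g: "g \<in> Hom ?C (b', \<theta>') (b, \<theta>)" "g \<cdot>\<^bsub>?C\<^esub> h = Idn ?C (b, \<theta>)"
    "h \<cdot>\<^bsub>?C\<^esub> g = Idn ?C (b', \<theta>')"
    using C.iso_arrowE[OF iso h] .
  obtain u where u: "h = ((b, \<theta>), u, (b', \<theta>'))" "u \<in> Hom B b b'"
    "\<theta>' \<cdot>\<^bsub>B\<^esub> u = amap F (amap U u) \<cdot>\<^bsub>B\<^esub> \<theta>"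
    using h unfolding Hom_def[of ?C]
    by (auto simp: coalg_cat_def) (auto simp: adj_comonad_def comp_ftor_def)
  obtain v where v: "g = ((b', \<theta>'), v, (b, \<theta>))" "v \<in> Hom B b' b"
    using g(1) unfolding Hom_def[of ?C] by (auto simp: coalg_cat_def)
  have "v \<cdot>\<^bsub>B\<^esub> u = Idn B b" "u \<cdot>\<^bsub>B\<^esub> v = Idn B b'"
    using g(2,3) u(1) v(1) by (auto simp: coalg_cat_def)
  then have "iso_arrow B u"
    using F.B.iso_arrowI u(2) v(2) by blast
  with u show thesis using that by blast
qed

text \<open>The comparison \<open>\<xi>'\<inverse> \<cdot> \<xi>\<close> commutes with the coalgebra structures because \<open>\<xi>\<close> and \<open>\<xi>'\<close> are both
  isomorphisms onto the same coalgebra \<open>(b, \<theta>)\<close>. The statement is one-sided: by symmetry it also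
  yields a factorization of \<open>i'\<close> through \<open>i\<close>.\<close>

lemma factor_if_Psi_rep_eq:
  assumes com: "comonadic A B F U \<eta> \<epsilon>" and b: "b \<in> Obj B"
    and i: "i \<in> Hom A a (omap U b)" "iso_arrow B (\<xi> b i)"
    and i': "i' \<in> Hom A a' (omap U b)" "iso_arrow B (\<xi> b i')"
    and eq: "Psi_rep B F U \<eta> \<epsilon> b (a, i) = Psi_rep B F U \<eta> \<epsilon> b (a', i')"
  obtains k where "k \<in> Hom A a a'" "i = i' \<cdot>\<^bsub>A\<^esub> k"
proof -
  let ?x = "\<xi> b i" and ?x' = "\<xi> b i'" and ?t = "Psi_rep B F U \<eta> \<epsilon> b (a, i)"
  let ?FU = "\<lambda>f. amap F (amap U f)"
  note a = F.A.Hom_Obj(1)[OF i(1)] and a' = F.A.Hom_Obj(1)[OF i'(1)]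
  note x = transpose_Hom[OF b i(1)] and x' = transpose_Hom[OF b i'(1)]
  note v = F.B.inv_arrow[OF i'(2) x']
  note Fn = F.amap_Hom[OF unit_Hom[OF a]] and Fn' = F.amap_Hom[OF unit_Hom[OF a']]
  note t = Psi_rep[OF b i]
  have t': "?t \<cdot>\<^bsub>B\<^esub> ?x' = amap F i'"
    using Psi_rep(2)[OF b i'] eq by simp
  define u where "u = inv_arrow B ?x' \<cdot>\<^bsub>B\<^esub> ?x"
  have u: "u \<in> Hom B (omap F a) (omap F a')"
    using F.B.Cmp_Hom[OF x v(1)] by (simp add: u_def)
  have xu: "?x' \<cdot>\<^bsub>B\<^esub> u = ?x"
    using F.B.Cmp_assoc[OF x v(1) x', symmetric] v(3) F.B.Idn_Cmp[OF x] by (simp add: u_def)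
  note FUx' = F.amap_Hom[OF U.amap_Hom[OF x']] and FUu = F.amap_Hom[OF U.amap_Hom[OF u]]
  have FUxu: "?FU ?x' \<cdot>\<^bsub>B\<^esub> ?FU u = ?FU ?x"
    using F.amap_Cmp[OF U.amap_Hom[OF u] U.amap_Hom[OF x']] U.amap_Cmp[OF u x'] xu by simp
  \<comment> \<open>The two sides of the square for \<open>u\<close> agree after composing with the isomorphism \<open>F U \<xi>'\<close>,
    where both become \<open>\<theta> \<cdot> \<xi> = F i\<close>.\<close>
  have "?FU ?x' \<cdot>\<^bsub>B\<^esub> (amap F (\<eta> a') \<cdot>\<^bsub>B\<^esub> u) = amap F i' \<cdot>\<^bsub>B\<^esub> u"
    using F.B.Cmp_assoc[OF u Fn' FUx'] amap_F_transpose[OF b i'(1)] by simp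
  also have "\<dots> = amap F i"
    using F.B.Cmp_assoc[OF u x' t(1)] t' xu t(2) by simp
  also have "\<dots> = ?FU ?x' \<cdot>\<^bsub>B\<^esub> (?FU u \<cdot>\<^bsub>B\<^esub> amap F (\<eta> a))"
    using F.B.Cmp_assoc[OF Fn FUu FUx'] FUxu amap_F_transpose[OF b i(1)] by simp
  finally have "amap F (\<eta> a') \<cdot>\<^bsub>B\<^esub> u = ?FU u \<cdot>\<^bsub>B\<^esub> amap F (\<eta> a)"
    using F.B.iso_cancel_left[OF F.iso_arrow_amap[OF U.iso_arrow_amap[OF i'(2) x']
        U.amap_Hom[OF x']] FUx'] F.B.Cmp_Hom[OF u Fn'] F.B.Cmp_Hom[OF Fn FUu] by blast
  then obtain k where k: "k \<in> Hom A a a'" "amap F k = u"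
    using comonadic_full[OF com a a' u] by blast
  have "\<xi> b (i' \<cdot>\<^bsub>A\<^esub> k) = ?x"
    using transpose_Cmp[OF b k(1) i'(1)] k(2) xu by simp
  then have "i = i' \<cdot>\<^bsub>A\<^esub> k"
    using amap_U_transpose[OF b i(1)] amap_U_transpose[OF b F.A.Cmp_Hom[OF k(1) i'(1)]] by simp
  with k(1) show thesis by (rule that)
qed

lemma Psi_rep_inject:
  assumes com: "comonadic A B F U \<eta> \<epsilon>" and b: "b \<in> Obj B"
    and p: "p \<in> Sub_reps A B F U \<epsilon> b" and q: "q \<in> Sub_reps A B F U \<epsilon> b"
    and eq: "Psi_rep B F U \<eta> \<epsilon> b p = Psi_rep B F U \<eta> \<epsilon> b q"
  shows "subobj_class A (omap U b) p = subobj_class A (omap U b) q"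
proof -
  obtain a i where p': "p = (a, i)" and i: "i \<in> Hom A a (omap U b)" "monic A i"
    "iso_arrow B (\<xi> b i)"
    using p by (auto simp: Sub_reps_def monos_into_def)
  obtain a' i' where q': "q = (a', i')" and i': "i' \<in> Hom A a' (omap U b)" "monic A i'"
    "iso_arrow B (\<xi> b i')"
    using q by (auto simp: Sub_reps_def monos_into_def)
  obtain k where k: "k \<in> Hom A a a'" "i = i' \<cdot>\<^bsub>A\<^esub> k"
    using factor_if_Psi_rep_eq[OF com b i(1,3) i'(1,3)] eq p' q' by metis
  obtain l where l: "l \<in> Hom A a' a" "i' = i \<cdot>\<^bsub>A\<^esub> l"
    using factor_if_Psi_rep_eq[OF com b i'(1,3) i(1,3)] eq p' q' by metis
  have "(p, q) \<in> subobj_rel A (omap U b)"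
    using F.A.subobj_relI[OF i(1,2) i'(1,2) k l] p' q' by simp
  then show ?thesis
    unfolding subobj_class_def by (rule equiv_class_eq[OF F.A.equiv_subobj_rel])
qed

text \<open>The preimage of \<open>\<theta>\<close> is the transpose, under the adjunction, of an isomorphism of coalgebras
  \<open>h : K a \<rightarrow> (b, \<theta>)\<close>.\<close>

lemma Psi_rep_surj:
  assumes com: "comonadic A B F U \<eta> \<epsilon>" and b: "b \<in> Obj B" and t: "\<theta> \<in> coalg_structures B G b"
  obtains p where "p \<in> Sub_reps A B F U \<epsilon> b" "Psi_rep B F U \<eta> \<epsilon> b p = \<theta>"
proof -
  have tH: "\<theta> \<in> Hom B b (omap F (omap U b))"
    using t by (simp add: coalg_structures_def adj_comonad_def comp_ftor_def)
  have "is_equivalence A (coalg_cat B G) (comparison A F \<eta>)" "(b, \<theta>) \<in> Obj (coalg_cat B G)"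
    using com b t by (simp_all add: comonadic_def coalg_cat_def)
  then obtain a h' where a: "a \<in> Obj A"
    and "h' \<in> Hom (coalg_cat B G) (omap F a, amap F (\<eta> a)) (b, \<theta>)" "iso_arrow (coalg_cat B G) h'"
    by (rule equivalence_essentially_surjective) (simp add: comparison_def)
  then obtain h where h: "h \<in> Hom B (omap F a) b" "iso_arrow B h"
    "\<theta> \<cdot>\<^bsub>B\<^esub> h = amap F (amap U h) \<cdot>\<^bsub>B\<^esub> amap F (\<eta> a)"
    using coalg_iso_underlying by blast
  define i where "i = amap U h \<cdot>\<^bsub>A\<^esub> \<eta> a"
  have i: "i \<in> Hom A a (omap U b)"
    using F.A.Cmp_Hom[OF unit_Hom[OF a] U.amap_Hom[OF h(1)]] by (simp add: i_def)
  have x: "\<xi> b i = h"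
    using transpose_amap_U[OF a h(1)] by (simp add: i_def)
  have "f = g" if f: "f \<in> Hom A c a" and g: "g \<in> Hom A c a" and fg: "i \<cdot>\<^bsub>A\<^esub> f = i \<cdot>\<^bsub>A\<^esub> g" for c f g
  proof -
    have "h \<cdot>\<^bsub>B\<^esub> amap F f = h \<cdot>\<^bsub>B\<^esub> amap F g"
      using transpose_Cmp[OF b f i] transpose_Cmp[OF b g i] x fg by simp
    then have "amap F f = amap F g"
      using F.B.iso_cancel_left[OF h(2,1)] F.amap_Hom f g by blast
    then show ?thesis
      using comonadic_faithful[OF com f g] by simp
  qed
  then have "monic A i"
    using i by (auto simp: monic_def Hom_def)
  then have "(a, i) \<in> Sub_reps A B F U \<epsilon> b"
    using i x h(2) by (simp add: Sub_reps_def monos_into_def)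
  moreover have "\<theta> \<cdot>\<^bsub>B\<^esub> \<xi> b i = amap F i"
    using h(3) amap_F_transpose[OF b i] x by simp
  then have "Psi_rep B F U \<eta> \<epsilon> b (a, i) = \<theta>"
    using Psi_rep_eq_iff[OF b i _ tH] x h(2) by simp
  ultimately show thesis by (rule that)
qed

lemma bij_betw_Psi:
  assumes com: "comonadic A B F U \<eta> \<epsilon>" and b: "b \<in> Obj B"
  shows "bij_betw (Psi B F U \<eta> \<epsilon> b) (Sub_F A B F U \<epsilon> b) (coalg_structures B G b)"
proof (rule bij_betw_imageI)
  show "inj_on (Psi B F U \<eta> \<epsilon> b) (Sub_F A B F U \<epsilon> b)"
  proof (rule inj_onI)
    fix S T assume "S \<in> Sub_F A B F U \<epsilon> b" "T \<in> Sub_F A B F U \<epsilon> b"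
      and eq: "Psi B F U \<eta> \<epsilon> b S = Psi B F U \<eta> \<epsilon> b T"
    then obtain p q where p: "p \<in> Sub_reps A B F U \<epsilon> b" "S = subobj_class A (omap U b) p"
      and q: "q \<in> Sub_reps A B F U \<epsilon> b" "T = subobj_class A (omap U b) q"
      unfolding Sub_F_def by blast
    have "Psi_rep B F U \<eta> \<epsilon> b p = Psi_rep B F U \<eta> \<epsilon> b q"
      using eq Psi_subobj_class[OF b p(1)] Psi_subobj_class[OF b q(1)] p(2) q(2) by metis
    then show "S = T"
      using Psi_rep_inject[OF com b p(1) q(1)] p(2) q(2) by metis
  qed
  have "Psi B F U \<eta> \<epsilon> b ` Sub_F A B F U \<epsilon> b = Psi_rep B F U \<eta> \<epsilon> b ` Sub_reps A B F U \<epsilon> b"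
    using Psi_subobj_class[OF b] unfolding Sub_F_def by (simp add: image_image)
  also have "\<dots> = coalg_structures B G b"
  proof (intro equalityI subsetI)
    fix \<theta> assume "\<theta> \<in> Psi_rep B F U \<eta> \<epsilon> b ` Sub_reps A B F U \<epsilon> b"
    then show "\<theta> \<in> coalg_structures B G b"
      using Psi_rep_coalg[OF b] by (auto simp: Sub_reps_def monos_into_def)
  next
    fix \<theta> assume "\<theta> \<in> coalg_structures B G b"
    then show "\<theta> \<in> Psi_rep B F U \<eta> \<epsilon> b ` Sub_reps A B F U \<epsilon> b"
      using Psi_rep_surj[OF com b] by (metis imageI)
  qed
  finally show "Psi B F U \<eta> \<epsilon> b ` Sub_F A B F U \<epsilon> b = coalg_structures B G b" .
qed

end

theorem proposition1p9:
  fixes A :: "('o1, 'm1) cat" and B :: "('o2, 'm2) cat"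
    and F :: "('o1, 'm1, 'o2, 'm2) ftor" and U :: "('o2, 'm2, 'o1, 'm1) ftor"
    and \<eta> :: "'o1 \<Rightarrow> 'm1" and \<epsilon> :: "'o2 \<Rightarrow> 'm2" and b\<^sub>0 :: 'o2
  assumes "adjunction A B F U \<eta> \<epsilon>"
    and "b\<^sub>0 \<in> Obj B"
    and "comonadic A B F U \<eta> \<epsilon>"
  shows "(\<forall>(a, i) \<in> Sub_reps A B F U \<epsilon> b\<^sub>0.
      Psi B F U \<eta> \<epsilon> b\<^sub>0 (subobj_class A (omap U b\<^sub>0) (a, i)) =
        amap F (amap U (adj_transpose B F \<epsilon> b\<^sub>0 i)) \<cdot>\<^bsub>B\<^esub> amap F (\<eta> a)
          \<cdot>\<^bsub>B\<^esub> inv_arrow B (adj_transpose B F \<epsilon> b\<^sub>0 i)) \<and>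
    bij_betw (Psi B F U \<eta> \<epsilon> b\<^sub>0) (Sub_F A B F U \<epsilon> b\<^sub>0)
      (coalg_structures B (adj_comonad F U \<eta> \<epsilon>) b\<^sub>0)"
proof -
  interpret adjunction A B F U \<eta> \<epsilon> by (rule assms(1))
  show ?thesis
    using Psi_subobj_class[OF assms(2)] bij_betw_Psi[OF assms(3,2)]
    by (auto simp: Psi_rep_def)
qed

end
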